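(* Let $\mathcal{L}$ be a linear network with resistance metric $\mathrm{d}_R$. Let $a:\mathcal{L}\to(0,\infty)$ and $b:\mathcal{L}\to(0,\infty)$ be functions, and define $\alpha(s,t)=[a(s)+a(t)]/2$ for $s,t\in\mathcal{L}$. Let $F$ be a positive finite measure on $(0,\infty)$. Then the function $$K(s,t)=\int_0^\infty \frac{\sqrt{b(s)b(t)}}{\sqrt{\alpha(s,t)+\mathrm{d}_R(s,t)\,w}}\,\mathrm{d}F(w),\qquad s,t\in\mathcal{L},$$ is positive semidefinite on $\mathcal{L}\times\mathcal{L}$.
   Context: Linear network: $\mathcal{L}=\bigcup_{i=1}^m\ell_i\subset\mathbb{R}^2$ is a finite union ($m<\infty$) of closed line segments, each of positive finite length $|\ell_i|$ and intersecting other segments only at endpoints; $\mathcal{L}$ is assumed path-connected. Graph and matrix $\boldsymbol{\Delta}$: let $\mathcal{V}=\{v_1,\dots,v_n\}$ be the set of endpoints of the segments. Write $v_i\sim v_j$ if the distinct vertices $v_i,v_j$ are the two endpoints of one of the segments. Set $\mathrm{con}(v_i,v_j)=1/\|v_i-v_j\|$ (Euclidean norm) if $v_i\sim v_j$ and $\mathrm{con}(v_i,v_j)=0$ otherwise, and $c(v_i)=\sum_{v\sim v_i}\mathrm{con}(v_i,v)$. Fix an arbitrary reference vertex $v^*\in\mathcal{V}$ (the resulting resistance metric does not depend on this choice). The $n\times n$ matrix $\boldsymbol{\Delta}$ indexed by $\mathcal{V}$ has entries $\boldsymbol{\Delta}(v^*,v^* )=1+c(v^* )$, $\boldsymbol{\Delta}(v_i,v_i)=c(v_i)$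 for $v_i\ne v^*$, and $\boldsymbol{\Delta}(v_i,v_j)=-\mathrm{con}(v_i,v_j)$ for $v_i\neq v_j$. It is strictly positive definite. Auxiliary Gaussian random field: $A(s)=A_0(s)+\sum_{i=1}^m A_i(s)$, $s\in\mathcal{L}$, where $A_0,\dots,A_m$ are independent Gaussian random fields such that: (i) $(A_0(v_1),\dots,A_0(v_n))^\top\sim\mathcal{N}_n(\mathbf{0},\boldsymbol{\Delta}^{-1})$, and $A_0$ is extended to each segment by linear interpolation (in arc length) between the values at its endpoints; (ii) for $i=1,\dots,m$, $A_i(s)=B_i(s)$ for $s\in\ell_i$ and $A_i(s)=0$ for $s\in\mathcal{L}\setminus\ell_i$, where $B_1,\dots,B_m$ are independent standard Brownian bridges, $B_i$ being defined on an interval of length $|\ell_i|$ (starting and ending at zero), identified with $\ell_i$ through arc length parameterization, and independent of $A_0$. Resistance metric: $\mathrm{d}_R(s,t)=\mathrm{var}[A(s)-A(t)]$, $s,t\in\mathcal{L}$. A function $K:\mathcal{L}\times\mathcal{L}\to\mathbb{R}$ is positive semidefinite if for every $N\in\mathbb{N}$ and all $s_1,\dots,s_N\in\mathcal{L}$ the matrix $[K(s_i,s_j)]_{i,j=1}^N$ is positive semidefinite. *)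

theory Defs
  imports "HOL-Probability.Probability"
begin

text \<open>
  A network is given by its number \<open>m\<close> of segments and by the two endpoints \<open>p i\<close>, \<open>q i\<close> of
  the \<open>i\<close>-th segment, \<open>1 \<le> i \<le> m\<close>. The order of the two endpoints only fixes
  the direction in which the segment is parameterized by arc length.
\<close>

definition network :: "nat \<Rightarrow> (nat \<Rightarrow> real^2) \<Rightarrow> (nat \<Rightarrow> real^2) \<Rightarrow> (real^2) set" where
  "network m p q = (\<Union>i\<in>{1..m}. closed_segment (p i) (q i))"

definition linear_network :: "nat \<Rightarrow> (nat \<Rightarrow> real^2) \<Rightarrow> (nat \<Rightarrow> real^2) \<Rightarrow> bool" where
  "linear_network m p q \<longleftrightarrow>
     (\<forall>i\<in>{1..m}. p i \<noteq> q i) \<and>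
     (\<forall>i\<in>{1..m}. \<forall>j\<in>{1..m}. i \<noteq> j \<longrightarrow>
        closed_segment (p i) (q i) \<inter> closed_segment (p j) (q j) \<subseteq> {p i, q i} \<inter> {p j, q j}) \<and>
     path_connected (network m p q)"

definition vertices :: "nat \<Rightarrow> (nat \<Rightarrow> real^2) \<Rightarrow> (nat \<Rightarrow> real^2) \<Rightarrow> (real^2) set" where
  "vertices m p q = p ` {1..m} \<union> q ` {1..m}"

definition adjacent :: "nat \<Rightarrow> (nat \<Rightarrow> real^2) \<Rightarrow> (nat \<Rightarrow> real^2) \<Rightarrow> real^2 \<Rightarrow> real^2 \<Rightarrow> bool" where
  "adjacent m p q u v \<longleftrightarrow> u \<noteq> v \<and> (\<exists>i\<in>{1..m}. {u, v} = {p i, q i})"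

definition con :: "nat \<Rightarrow> (nat \<Rightarrow> real^2) \<Rightarrow> (nat \<Rightarrow> real^2) \<Rightarrow> real^2 \<Rightarrow> real^2 \<Rightarrow> real" where
  "con m p q u v = (if adjacent m p q u v then 1 / norm (u - v) else 0)"

definition total_con :: "nat \<Rightarrow> (nat \<Rightarrow> real^2) \<Rightarrow> (nat \<Rightarrow> real^2) \<Rightarrow> real^2 \<Rightarrow> real" where
  "total_con m p q u = (\<Sum>v\<in>{v \<in> vertices m p q. adjacent m p q v u}. con m p q u v)"

definition Delta :: "nat \<Rightarrow> (nat \<Rightarrow> real^2) \<Rightarrow> (nat \<Rightarrow> real^2) \<Rightarrow> real^2 \<Rightarrow> real^2 \<Rightarrow> real^2 \<Rightarrow> real" where
  "Delta m p q vstar u v =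
     (if u = v then (if u = vstar then 1 + total_con m p q u else total_con m p q u)
      else - con m p q u v)"

text \<open>Matrices whose rows and columns are indexed by a finite set \<open>V\<close> are functions of two
  arguments, of which only the values on \<open>V\<close> matter.\<close>

definition inverse_matrix_on :: "'i set \<Rightarrow> ('i \<Rightarrow> 'i \<Rightarrow> real) \<Rightarrow> ('i \<Rightarrow> 'i \<Rightarrow> real) \<Rightarrow> bool" where
  "inverse_matrix_on V D E \<longleftrightarrow>
     (\<forall>u\<in>V. \<forall>v\<in>V. (\<Sum>x\<in>V. D u x * E x v) = (if u = v then 1 else 0) \<and>
                   (\<Sum>x\<in>V. E u x * D x v) = (if u = v then 1 else 0))"

text \<open>The univariate normal law with mean \<open>\<mu>\<close> and variance \<open>v\<close>, including the degenerate case
  \<open>v = 0\<close> of a point mass at \<open>\<mu>\<close>.\<close>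

definition normal_rv :: "'w measure \<Rightarrow> real \<Rightarrow> real \<Rightarrow> ('w \<Rightarrow> real) \<Rightarrow> bool" where
  "normal_rv M \<mu> v X \<longleftrightarrow>
     X \<in> borel_measurable M \<and>
     (v = 0 \<and> (AE \<omega> in M. X \<omega> = \<mu>) \<or>
      v > 0 \<and> distributed M lborel X (\<lambda>x. ennreal (normal_density \<mu> (sqrt v) x)))"

text \<open>A random vector is multivariate normal if each linear combination of its components is
  univariate normal with the mean and variance dictated by \<open>\<mu>\<close> and \<open>\<Sigma>\<close>.\<close>

definition multivariate_normal ::
  "'w measure \<Rightarrow> 'i set \<Rightarrow> ('i \<Rightarrow> real) \<Rightarrow> ('i \<Rightarrow> 'i \<Rightarrow> real) \<Rightarrow> ('i \<Rightarrow> 'w \<Rightarrow> real) \<Rightarrow> bool" where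
  "multivariate_normal M J \<mu> \<Sigma> X \<longleftrightarrow>
     (\<forall>c. normal_rv M (\<Sum>i\<in>J. c i * \<mu> i) (\<Sum>i\<in>J. \<Sum>j\<in>J. c i * c j * \<Sigma> i j)
            (\<lambda>\<omega>. \<Sum>i\<in>J. c i * X i \<omega>))"

definition gaussian_process ::
  "'w measure \<Rightarrow> 'i set \<Rightarrow> ('i \<Rightarrow> real) \<Rightarrow> ('i \<Rightarrow> 'i \<Rightarrow> real) \<Rightarrow> ('i \<Rightarrow> 'w \<Rightarrow> real) \<Rightarrow> bool" where
  "gaussian_process M T \<mu> C X \<longleftrightarrow>
     (\<forall>J. finite J \<and> J \<subseteq> T \<longrightarrow> multivariate_normal M J \<mu> C X)"

text \<open>The standard Brownian bridge on \<open>{0..T}\<close>; the covariance vanishes at \<open>0\<close> and \<open>T\<close>, so the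
  bridge starts and ends at zero almost surely.\<close>

definition brownian_bridge :: "'w measure \<Rightarrow> real \<Rightarrow> (real \<Rightarrow> 'w \<Rightarrow> real) \<Rightarrow> bool" where
  "brownian_bridge M T B \<longleftrightarrow>
     gaussian_process M {0..T} (\<lambda>_. 0) (\<lambda>s t. min s t - s * t / T) B \<and>
     (AE \<omega> in M. continuous_on {0..T} (\<lambda>t. B t \<omega>))"

definition bridge_field ::
  "(nat \<Rightarrow> real^2) \<Rightarrow> (nat \<Rightarrow> real^2) \<Rightarrow> (nat \<Rightarrow> real \<Rightarrow> 'w \<Rightarrow> real) \<Rightarrow>
   nat \<Rightarrow> real^2 \<Rightarrow> 'w \<Rightarrow> real" where
  "bridge_field p q B i s \<omega> =
     (if s \<in> closed_segment (p i) (q i) then B i (dist (p i) s) \<omega> else 0)"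

text \<open>Independence of the random fields is independence of the random elements they induce in the
  space of real functions on the network with its product \<open>\<sigma>\<close>-algebra.\<close>

definition auxiliary_components ::
  "nat \<Rightarrow> (nat \<Rightarrow> real^2) \<Rightarrow> (nat \<Rightarrow> real^2) \<Rightarrow> real^2 \<Rightarrow>
   'w measure \<Rightarrow> (real^2 \<Rightarrow> 'w \<Rightarrow> real) \<Rightarrow> (nat \<Rightarrow> real \<Rightarrow> 'w \<Rightarrow> real) \<Rightarrow> bool" where
  "auxiliary_components m p q vstar M A0 B \<longleftrightarrow>
     prob_space M \<and>
     (\<exists>E. inverse_matrix_on (vertices m p q) (Delta m p q vstar) E \<and>
          multivariate_normal M (vertices m p q) (\<lambda>_. 0) E A0) \<and>
     (\<forall>i\<in>{1..m}. \<forall>s\<in>closed_segment (p i) (q i). \<forall>\<omega>\<in>space M.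
        A0 s \<omega> = (1 - dist (p i) s / dist (p i) (q i)) * A0 (p i) \<omega>
                 + dist (p i) s / dist (p i) (q i) * A0 (q i) \<omega>) \<and>
     (\<forall>i\<in>{1..m}. brownian_bridge M (dist (p i) (q i)) (B i)) \<and>
     prob_space.indep_vars M (\<lambda>_. PiM (network m p q) (\<lambda>_. borel))
       (\<lambda>i \<omega>. \<lambda>s\<in>network m p q. if i = 0 then A0 s \<omega> else bridge_field p q B i s \<omega>) {0..m}"

definition auxiliary_field ::
  "nat \<Rightarrow> (nat \<Rightarrow> real^2) \<Rightarrow> (nat \<Rightarrow> real^2) \<Rightarrow>
   (real^2 \<Rightarrow> 'w \<Rightarrow> real) \<Rightarrow> (nat \<Rightarrow> real \<Rightarrow> 'w \<Rightarrow> real) \<Rightarrow> real^2 \<Rightarrow> 'w \<Rightarrow> real" where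
  "auxiliary_field m p q A0 B s \<omega> = A0 s \<omega> + (\<Sum>i\<in>{1..m}. bridge_field p q B i s \<omega>)"

definition resistance_metric ::
  "nat \<Rightarrow> (nat \<Rightarrow> real^2) \<Rightarrow> (nat \<Rightarrow> real^2) \<Rightarrow> 'w measure \<Rightarrow>
   (real^2 \<Rightarrow> 'w \<Rightarrow> real) \<Rightarrow> (nat \<Rightarrow> real \<Rightarrow> 'w \<Rightarrow> real) \<Rightarrow> real^2 \<Rightarrow> real^2 \<Rightarrow> real" where
  "resistance_metric m p q M A0 B s t =
     prob_space.variance M (\<lambda>\<omega>. auxiliary_field m p q A0 B s \<omega> - auxiliary_field m p q A0 B t \<omega>)"

definition pos_semidef_matrix :: "nat \<Rightarrow> (nat \<Rightarrow> nat \<Rightarrow> real) \<Rightarrow> bool" where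
  "pos_semidef_matrix N A \<longleftrightarrow>
     (\<forall>i\<in>{1..N}. \<forall>j\<in>{1..N}. A i j = A j i) \<and>
     (\<forall>c :: nat \<Rightarrow> real. (\<Sum>i\<in>{1..N}. \<Sum>j\<in>{1..N}. c i * A i j * c j) \<ge> 0)"

definition pos_semidef_on :: "'a set \<Rightarrow> ('a \<Rightarrow> 'a \<Rightarrow> real) \<Rightarrow> bool" where
  "pos_semidef_on S K \<longleftrightarrow>
     (\<forall>N. \<forall>s :: nat \<Rightarrow> 'a. (\<forall>i\<in>{1..N}. s i \<in> S) \<longrightarrow>
        pos_semidef_matrix N (\<lambda>i j. K (s i) (s j)))"

end

theory Submission
  imports Defs
begin

text \<open>
  Since \<open>1 / sqrt y\<close> is a mixture of the functions \<open>exp (- (y * u\<^sup>2))\<close> and the factor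
  \<open>exp (- (a s + a t) / 2 * u\<^sup>2)\<close> splits into a function of \<open>s\<close> times one of \<open>t\<close>, it is enough
  that \<open>exp (- r * d s t)\<close> is positive semidefinite for \<open>r \<ge> 0\<close>, where \<open>d s t\<close> is the variance of
  \<open>X s - X t\<close> for a square integrable field \<open>X\<close>. With \<open>C\<close> the covariance of \<open>X\<close> one has
  \<open>d s t = C s s + C t t - 2 * C s t\<close>, and the entrywise exponential of \<open>2 * r * C\<close> is positive
  semidefinite by the Schur product theorem. The latter is immediate when one factor is a covariance:
  the quadratic form of the product is the expectation of a random quadratic form of the other factor.
\<close>

section \<open>Entrywise products and exponentials of covariance matrices\<close>

lemma integral_double_sum:
  fixes f :: "'i \<Rightarrow> 'i \<Rightarrow> 'w \<Rightarrow> real"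
  assumes "\<And>i j. i \<in> I \<Longrightarrow> j \<in> I \<Longrightarrow> integrable M (f i j)"
  shows "(LINT x|M. (\<Sum>i\<in>I. \<Sum>j\<in>I. c i j * f i j x)) = (\<Sum>i\<in>I. \<Sum>j\<in>I. c i j * (LINT x|M. f i j x))"
  by (subst Bochner_Integration.integral_sum)
    (auto intro!: sum.cong Bochner_Integration.integrable_sum assms
      simp: Bochner_Integration.integral_sum assms)

lemma covariance_schur_product_nonneg:
  fixes Y :: "'i \<Rightarrow> 'w \<Rightarrow> real" and P :: "'i \<Rightarrow> 'i \<Rightarrow> real"
  assumes int: "\<And>i j. i \<in> I \<Longrightarrow> j \<in> I \<Longrightarrow> integrable M (\<lambda>\<omega>. Y i \<omega> * Y j \<omega>)"
    and P: "\<And>c. 0 \<le> (\<Sum>i\<in>I. \<Sum>j\<in>I. c i * P i j * c j)"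
  shows "0 \<le> (\<Sum>i\<in>I. \<Sum>j\<in>I. c i * (P i j * (LINT \<omega>|M. Y i \<omega> * Y j \<omega>)) * c j)"
proof -
  \<comment> \<open>For each fixed \<omega> the form of \<open>P\<close> is taken at the
    coefficients \<open>c i * Y i \<omega>\<close>.\<close>
  have "0 \<le> (LINT \<omega>|M. (\<Sum>i\<in>I. \<Sum>j\<in>I. (c i * Y i \<omega>) * P i j * (c j * Y j \<omega>)))"
    by (intro integral_nonneg_AE AE_I2 P)
  also have "\<dots> = (LINT \<omega>|M. (\<Sum>i\<in>I. \<Sum>j\<in>I. (c i * P i j * c j) * (Y i \<omega> * Y j \<omega>)))"
    by (intro Bochner_Integration.integral_cong refl sum.cong) (simp add: mult_ac)
  also have "\<dots> = (\<Sum>i\<in>I. \<Sum>j\<in>I. (c i * P i j * c j) * (LINT \<omega>|M. Y i \<omega> * Y j \<omega>))"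
    by (rule integral_double_sum) (rule int)
  finally show ?thesis
    by (simp add: mult_ac)
qed

text \<open>Each term of the exponential series is a nonnegative multiple,
  \<open>r ^ k / fact k\<close>, of the form of the entrywise power \<open>C i j ^ k\<close>. These
  forms are nonnegative by induction: the zeroth power is the all-ones matrix, and each further
  factor \<open>C\<close> is a covariance, so the Schur product lemma applies.\<close>

lemma exp_covariance_nonneg:
  fixes Y :: "'i \<Rightarrow> 'w \<Rightarrow> real"
  assumes int: "\<And>i j. i \<in> I \<Longrightarrow> j \<in> I \<Longrightarrow> integrable M (\<lambda>\<omega>. Y i \<omega> * Y j \<omega>)"
    and r: "0 \<le> r"
  shows "0 \<le> (\<Sum>i\<in>I. \<Sum>j\<in>I. c i * exp (r * (LINT \<omega>|M. Y i \<omega> * Y j \<omega>)) * c j)"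
proof -
  define C where "C i j = (LINT \<omega>|M. Y i \<omega> * Y j \<omega>)" for i j
  have pow: "0 \<le> (\<Sum>i\<in>I. \<Sum>j\<in>I. c i * C i j ^ k * c j)" for k c
  proof (induction k arbitrary: c)
    case 0
    have "(\<Sum>i\<in>I. \<Sum>j\<in>I. c i * C i j ^ 0 * c j) = (\<Sum>i\<in>I. c i)\<^sup>2"
      by (simp add: power2_eq_square sum_product)
    then show ?case by simp
  next
    case (Suc k)
    from covariance_schur_product_nonneg[OF int Suc] show ?case
      by (simp add: C_def mult_ac)
  qed
  have "(\<lambda>k. \<Sum>i\<in>I. \<Sum>j\<in>I. c i * ((r * C i j) ^ k /\<^sub>R fact k) * c j) sums
      (\<Sum>i\<in>I. \<Sum>j\<in>I. c i * exp (r * C i j) * c j)"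
    by (intro sums_sum sums_mult sums_mult2 exp_converges)
  moreover have "0 \<le> (\<Sum>i\<in>I. \<Sum>j\<in>I. c i * ((r * C i j) ^ k /\<^sub>R fact k) * c j)" for k
  proof -
    have "(\<Sum>i\<in>I. \<Sum>j\<in>I. c i * ((r * C i j) ^ k /\<^sub>R fact k) * c j) =
        r ^ k / fact k * (\<Sum>i\<in>I. \<Sum>j\<in>I. c i * C i j ^ k * c j)"
      by (simp add: sum_distrib_left power_mult_distrib field_simps)
    then show ?thesis
      using pow r by simp
  qed
  ultimately show ?thesis
    unfolding C_def[symmetric] by (metis (no_types, lifting) sums_le sums_zero)
qed

section \<open>Square integrable random variables\<close>

lemma integrable_mult_of_square_integrable:
  fixes f g :: "'w \<Rightarrow> real"
  assumes [measurable]: "f \<in> borel_measurable M" "g \<in> borel_measurable M"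
    and "integrable M (\<lambda>x. (f x)\<^sup>2)" "integrable M (\<lambda>x. (g x)\<^sup>2)"
  shows "integrable M (\<lambda>x. f x * g x)"
proof (rule Bochner_Integration.integrable_bound)
  show "integrable M (\<lambda>x. (f x)\<^sup>2 + (g x)\<^sup>2)"
    using assms by simp
  have "\<bar>x * y\<bar> \<le> x\<^sup>2 + y\<^sup>2" for x y :: real
  proof -
    have "\<bar>x\<bar> * \<bar>y\<bar> * 2 \<le> x\<^sup>2 + y\<^sup>2"
      using zero_le_power2[of "\<bar>x\<bar> - \<bar>y\<bar>"] by (simp add: power2_diff)
    moreover have "0 \<le> \<bar>x\<bar> * \<bar>y\<bar>" by simp
    ultimately show ?thesis unfolding abs_mult by linarith
  qed
  then show "AE x in M. norm (f x * g x) \<le> norm ((f x)\<^sup>2 + (g x)\<^sup>2)"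
    by (intro AE_I2) simp
qed measurable

text \<open>Measurability is bundled in so that the closure rules below chain without side
  conditions.\<close>

definition square_integrable :: "'w measure \<Rightarrow> ('w \<Rightarrow> real) \<Rightarrow> bool" where
  "square_integrable M f \<longleftrightarrow> f \<in> borel_measurable M \<and> integrable M (\<lambda>x. (f x)\<^sup>2)"

lemma square_integrable_mult:
  "square_integrable M f \<Longrightarrow> square_integrable M g \<Longrightarrow> integrable M (\<lambda>x. f x * g x)"
  unfolding square_integrable_def by (intro integrable_mult_of_square_integrable) auto

lemma square_integrable_const [simp]: "finite_measure M \<Longrightarrow> square_integrable M (\<lambda>x. c)"
  unfolding square_integrable_def by (simp add: finite_measure.integrable_const)

lemma square_integrable_cmult:
  "square_integrable M f \<Longrightarrow> square_integrable M (\<lambda>x. c * f x)"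
  unfolding square_integrable_def by (auto simp: power_mult_distrib)

lemma square_integrable_add:
  assumes "square_integrable M f" "square_integrable M g"
  shows "square_integrable M (\<lambda>x. f x + g x)"
  using assms square_integrable_mult[OF assms]
  unfolding square_integrable_def by (auto simp: power2_sum mult.assoc)

lemma square_integrable_sum:
  assumes "finite_measure M" "\<And>i. i \<in> I \<Longrightarrow> square_integrable M (f i)"
  shows "square_integrable M (\<lambda>x. \<Sum>i\<in>I. f i x)"
  using assms(2)
  by (induction I rule: infinite_finite_induct) (auto intro: square_integrable_add simp: assms(1))

lemma square_integrable_cong:
  assumes "\<And>x. x \<in> space M \<Longrightarrow> f x = g x"
  shows "square_integrable M f = square_integrable M g"
  using assms unfolding square_integrable_def
  by (intro arg_cong2[where f = "(\<and>)"] measurable_cong Bochner_Integration.integrable_cong) auto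

text \<open>In the degenerate case \<open>X\<close> vanishes almost everywhere; otherwise the claim
  is the finite second moment of the normal density.\<close>

lemma square_integrable_normal_rv:
  assumes "normal_rv M 0 v X"
  shows "square_integrable M X"
  using assms unfolding normal_rv_def square_integrable_def
proof (elim conjE disjE, goal_cases)
  case 1
  then have "integrable M (\<lambda>x. (X x)\<^sup>2) \<longleftrightarrow> integrable M (\<lambda>x. 0 :: real)"
    by (intro integrable_cong_AE) (auto elim: eventually_mono)
  with 1 show ?case by simp
next
  case 2
  have "integrable lborel (\<lambda>x. normal_density 0 (sqrt v) x * x ^ 2)"
    using integrable_normal_moment[of "sqrt v" 0 2] 2 by simp
  then have "integrable M (\<lambda>x. (X x)\<^sup>2)"
    using 2 by (subst distributed_integrable[symmetric, where g = "\<lambda>x. x\<^sup>2"]) auto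
  with 2 show ?case by simp
qed

lemma square_integrable_multivariate_normal:
  assumes "multivariate_normal M J (\<lambda>_. 0) \<Sigma> X" "finite J" "i \<in> J"
  shows "square_integrable M (X i)"
proof -
  \<comment> \<open>The unit coefficient vector at \<open>i\<close> extracts a single component; the
    value of its variance is irrelevant here.\<close>
  define v where "v = (\<Sum>k\<in>J. \<Sum>l\<in>J. of_bool (k = i) * of_bool (l = i) * \<Sigma> k l)"
  have "normal_rv M 0 v (\<lambda>\<omega>. \<Sum>k\<in>J. of_bool (k = i) * X k \<omega>)"
    using assms(1)[unfolded multivariate_normal_def, rule_format, of "\<lambda>k. of_bool (k = i)"]
    by (simp add: v_def)
  moreover have "(\<Sum>k\<in>J. of_bool (k = i) * X k \<omega>) = X i \<omega>" for \<omega>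
    using assms by (simp add: of_bool_def if_distrib[of "\<lambda>x. x * _"] cong: if_cong)
  ultimately show ?thesis
    by (auto intro: square_integrable_normal_rv)
qed

section \<open>From variograms to inverse square roots\<close>

lemma (in prob_space) exp_variogram_nonneg:
  fixes X :: "'i \<Rightarrow> 'a \<Rightarrow> real"
  assumes X: "\<And>i. i \<in> I \<Longrightarrow> square_integrable M (X i)" and r: "0 \<le> r"
  shows "0 \<le> (\<Sum>i\<in>I. \<Sum>j\<in>I. c i * exp (- r * variance (\<lambda>\<omega>. X i \<omega> - X j \<omega>)) * c j)"
proof -
  \<comment> \<open>Centring turns covariances into plain second moments, the form that
    \<open>exp_covariance_nonneg\<close> handles.\<close>
  define Y where "Y i \<omega> = X i \<omega> - expectation (X i)" for i \<omega>
  define C where "C i j = expectation (\<lambda>\<omega>. Y i \<omega> * Y j \<omega>)" for i j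
  have fin: "finite_measure M" by unfold_locales
  have Y: "square_integrable M (Y i)" if "i \<in> I" for i
    using square_integrable_add[OF X[OF that] square_integrable_const[OF fin]]
    unfolding Y_def diff_conv_add_uminus .
  have intY: "integrable M (\<lambda>\<omega>. Y i \<omega> * Y j \<omega>)" if "i \<in> I" "j \<in> I" for i j
    using that by (intro square_integrable_mult Y)
  have intX: "integrable M (X i)" if "i \<in> I" for i
    using square_integrable_mult[OF X[OF that] square_integrable_const[OF fin, of 1]] by simp
  have var: "variance (\<lambda>\<omega>. X i \<omega> - X j \<omega>) = C i i + C j j - 2 * C i j" if "i \<in> I" "j \<in> I" for i j
  proof -
    have "variance (\<lambda>\<omega>. X i \<omega> - X j \<omega>) =
        expectation (\<lambda>\<omega>. Y i \<omega> * Y i \<omega> + Y j \<omega> * Y j \<omega> - 2 * (Y i \<omega> * Y j \<omega>))"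
      using that by (intro Bochner_Integration.integral_cong refl)
        (simp add: intX Y_def power2_eq_square algebra_simps)
    also have "\<dots> = C i i + C j j - 2 * C i j"
      using that by (simp add: intY C_def)
    finally show ?thesis .
  qed
  \<comment> \<open>The diagonal terms \<open>C i i\<close> and \<open>C j j\<close> each depend on
    one index only and are absorbed into the coefficients.\<close>
  have "c i * exp (- r * variance (\<lambda>\<omega>. X i \<omega> - X j \<omega>)) * c j =
      (c i * exp (- r * C i i)) * exp (2 * r * C i j) * (c j * exp (- r * C j j))"
    if "i \<in> I" "j \<in> I" for i j
    unfolding var[OF that] by (simp add: algebra_simps exp_add exp_diff exp_minus field_simps)
  then have "(\<Sum>i\<in>I. \<Sum>j\<in>I. c i * exp (- r * variance (\<lambda>\<omega>. X i \<omega> - X j \<omega>)) * c j) =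
      (\<Sum>i\<in>I. \<Sum>j\<in>I. (c i * exp (- r * C i i)) * exp (2 * r * C i j) * (c j * exp (- r * C j j)))"
    by (intro sum.cong refl)
  moreover have "0 \<le> \<dots>"
    unfolding C_def using r by (intro exp_covariance_nonneg intY) auto
  ultimately show ?thesis by simp
qed

text \<open>The integrand is a multiple of the centred normal density with variance
  \<open>1 / (2 * y)\<close>, and the multiple is the normalising constant
  \<open>sqrt pi / sqrt y\<close>.\<close>

lemma
  fixes y :: real
  assumes "0 < y"
  shows integrable_exp_neg_square: "integrable lborel (\<lambda>u. exp (- (y * u\<^sup>2)))"
    and integral_exp_neg_square: "(LINT u|lborel. exp (- (y * u\<^sup>2))) = sqrt pi / sqrt y"
proof -
  define \<sigma> where "\<sigma> = 1 / sqrt (2 * y)"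
  have \<sigma>: "0 < \<sigma>" "\<sigma>\<^sup>2 = 1 / (2 * y)"
    using assms by (auto simp: \<sigma>_def power_divide)
  have eq: "(\<lambda>u. exp (- (y * u\<^sup>2))) = (\<lambda>u. sqrt pi / sqrt y * normal_density 0 \<sigma> u)"
    using assms by (auto simp: normal_density_def \<sigma> real_sqrt_divide field_simps)
  show "integrable lborel (\<lambda>u. exp (- (y * u\<^sup>2)))"
    unfolding eq using \<sigma> by simp
  show "(LINT u|lborel. exp (- (y * u\<^sup>2))) = sqrt pi / sqrt y"
    unfolding eq using \<sigma> by simp
qed

lemma inverse_sqrt_variogram_nonneg:
  fixes d :: "'i \<Rightarrow> 'i \<Rightarrow> real"
  assumes d: "\<And>i j. i \<in> I \<Longrightarrow> j \<in> I \<Longrightarrow> 0 \<le> d i j"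
    and exp_d: "\<And>r c. 0 \<le> r \<Longrightarrow> 0 \<le> (\<Sum>i\<in>I. \<Sum>j\<in>I. c i * exp (- r * d i j) * c j)"
    and a: "\<And>i. i \<in> I \<Longrightarrow> 0 < a i"
    and w: "0 \<le> w"
  shows "0 \<le> (\<Sum>i\<in>I. \<Sum>j\<in>I. c i * (1 / sqrt ((a i + a j) / 2 + d i j * w)) * c j)"
proof -
  \<comment> \<open>Positivity of \<open>a\<close> keeps \<open>y i j\<close> positive even where
    \<open>d i j * w\<close> vanishes, so the Gaussian integrals converge.\<close>
  define y where "y i j = (a i + a j) / 2 + d i j * w" for i j
  have pos: "0 < y i j" if "i \<in> I" "j \<in> I" for i j
    unfolding y_def using that a[of i] a[of j] d[of i j] w by (intro add_pos_nonneg) auto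
  \<comment> \<open>For fixed \<open>u\<close>, \<open>exp_d\<close> is used with
    \<open>r = w * u\<^sup>2\<close> and with the factors coming from \<open>a\<close> moved into
    the coefficients.\<close>
  have "0 \<le> (LINT u|lborel. (\<Sum>i\<in>I. \<Sum>j\<in>I. (c i * exp (- (a i / 2) * u\<^sup>2)) *
      exp (- (w * u\<^sup>2) * d i j) * (c j * exp (- (a j / 2) * u\<^sup>2))))"
    using w by (intro integral_nonneg_AE AE_I2 exp_d) simp
  also have "\<dots> = (LINT u|lborel. (\<Sum>i\<in>I. \<Sum>j\<in>I.
      (c i * c j) * exp (- (y i j * u\<^sup>2))))"
    by (intro Bochner_Integration.integral_cong refl sum.cong)
      (simp add: y_def algebra_simps add_divide_distrib flip: exp_add exp_minus exp_diff)
  also have "\<dots> = (\<Sum>i\<in>I. \<Sum>j\<in>I. (c i * c j) * (sqrt pi / sqrt (y i j)))"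
    by (subst integral_double_sum)
      (auto intro!: sum.cong simp: integrable_exp_neg_square integral_exp_neg_square pos)
  also have "\<dots> = sqrt pi * (\<Sum>i\<in>I. \<Sum>j\<in>I. c i * (1 / sqrt ((a i + a j) / 2 + d i j * w)) * c j)"
    by (simp add: y_def sum_distrib_left mult_ac)
  finally show ?thesis
    using pi_gt_zero by (simp only: zero_le_mult_iff real_sqrt_ge_0_iff real_sqrt_le_0_iff) linarith
qed

section \<open>The auxiliary field and the kernel on the network\<close>

text \<open>This makes \<open>exp_variogram_nonneg\<close> applicable to the field. At a point of
  the network, \<open>A0\<close> is a fixed linear combination of two vertex values, and every
  bridge term is either a Gaussian variable or zero.\<close>

lemma square_integrable_auxiliary_field:
  assumes aux: "auxiliary_components m p q vstar M A0 B" and s: "s \<in> network m p q"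
  shows "square_integrable M (auxiliary_field m p q A0 B s)"
proof -
  have "prob_space M"
    using aux by (simp add: auxiliary_components_def)
  then interpret prob_space M .
  have fin: "finite_measure M" by unfold_locales
  have finV: "finite (vertices m p q)"
    by (simp add: vertices_def)
  obtain E where "multivariate_normal M (vertices m p q) (\<lambda>_. 0) E A0"
    using aux by (auto simp: auxiliary_components_def)
  then have vertex: "square_integrable M (A0 v)" if "v \<in> vertices m p q" for v
    using finV that by (rule square_integrable_multivariate_normal)
  obtain i where i: "i \<in> {1..m}" "s \<in> closed_segment (p i) (q i)"
    using s by (auto simp: network_def)
  have interpolation: "A0 s \<omega> = (1 - dist (p i) s / dist (p i) (q i)) * A0 (p i) \<omega>
      + dist (p i) s / dist (p i) (q i) * A0 (q i) \<omega>" if "\<omega> \<in> space M" for \<omega>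
    using aux i that unfolding auxiliary_components_def by blast
  have "square_integrable M (\<lambda>\<omega>. (1 - dist (p i) s / dist (p i) (q i)) * A0 (p i) \<omega>
      + dist (p i) s / dist (p i) (q i) * A0 (q i) \<omega>)"
    using i by (intro square_integrable_add square_integrable_cmult vertex) (auto simp: vertices_def)
  then have A0: "square_integrable M (A0 s)"
    using interpolation by (simp cong: square_integrable_cong)
  have "square_integrable M (bridge_field p q B j s)" if j: "j \<in> {1..m}" for j
  proof (cases "s \<in> closed_segment (p j) (q j)")
    case True
    \<comment> \<open>The bridge is a Gaussian process, so its law at the single time
      \<open>dist (p j) s\<close> is normal; that time lies in the parameter interval because
      \<open>s\<close> is on the segment.\<close>
    have "multivariate_normal M {dist (p j) s} (\<lambda>_. 0)
        (\<lambda>s t. min s t - s * t / dist (p j) (q j)) (B j)"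
      using aux j dist_in_closed_segment[OF True]
      by (auto simp: auxiliary_components_def brownian_bridge_def gaussian_process_def dist_commute)
    then have "square_integrable M (B j (dist (p j) s))"
      by (rule square_integrable_multivariate_normal) auto
    then show ?thesis
      using True by (simp add: bridge_field_def[abs_def])
  next
    case False
    then show ?thesis
      using fin by (simp add: bridge_field_def[abs_def])
  qed
  then show ?thesis
    unfolding auxiliary_field_def[abs_def]
    by (intro square_integrable_add square_integrable_sum A0 fin)
qed

theorem theorem3p1:
  fixes m :: nat and p q :: "nat \<Rightarrow> real^2" and vstar :: "real^2"
    and M :: "'w measure" and A0 :: "real^2 \<Rightarrow> 'w \<Rightarrow> real" and B :: "nat \<Rightarrow> real \<Rightarrow> 'w \<Rightarrow> real"
    and a b :: "real^2 \<Rightarrow> real" and F :: "real measure"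
  assumes "linear_network m p q"
    and "vstar \<in> vertices m p q"
    and "auxiliary_components m p q vstar M A0 B"
    and "\<And>s. s \<in> network m p q \<Longrightarrow> a s > 0"
    and "\<And>s. s \<in> network m p q \<Longrightarrow> b s > 0"
    and "sets F = sets (restrict_space borel {0<..})"
    and "finite_measure F"
  shows "pos_semidef_on (network m p q)
    (\<lambda>s t. LINT w|F. sqrt (b s * b t) /
       sqrt ((a s + a t) / 2 + resistance_metric m p q M A0 B s t * w))"
proof -
  note aux = assms(3) and a = assms(4) and setsF = assms(6)
  interpret F: finite_measure F by fact
  have "prob_space M"
    using aux by (simp add: auxiliary_components_def)
  then interpret prob_space M .
  define X where "X = auxiliary_field m p q A0 B"
  define d where "d = resistance_metric m p q M A0 B"
  have d_eq: "d s t = variance (\<lambda>\<omega>. X s \<omega> - X t \<omega>)" for s t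
    by (simp add: d_def X_def resistance_metric_def)
  have X: "square_integrable M (X s)" if "s \<in> network m p q" for s
    unfolding X_def using aux that by (rule square_integrable_auxiliary_field)
  have d_nonneg: "0 \<le> d s t" for s t
    unfolding d_eq by (rule variance_positive)
  have d_commute: "d s t = d t s" for s t
  proof -
    \<comment> \<open>Swapping the points flips the sign of the centred difference, which squaring
      removes.\<close>
    have "expectation (\<lambda>\<omega>. X t \<omega> - X s \<omega>) = - expectation (\<lambda>\<omega>. X s \<omega> - X t \<omega>)"
      by (subst integral_minus[symmetric]) simp
    then show ?thesis
      unfolding d_eq
      by (intro Bochner_Integration.integral_cong refl) (simp add: power2_eq_square algebra_simps)
  qed
  have spaceF: "space F = {0<..}"
    using sets_eq_imp_space_eq[OF setsF] by simp
  \<comment> \<open>The integrand is bounded by its value at \<open>w = 0\<close>, and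
    \<open>F\<close> is finite. Integrability is what lets the double sum pass through the integral
    below.\<close>
  have int: "integrable F (\<lambda>w. 1 / sqrt ((a s + a t) / 2 + d s t * w))"
    if "s \<in> network m p q" "t \<in> network m p q" for s t
  proof (rule F.integrable_const_bound)
    have "1 / sqrt ((a s + a t) / 2 + d s t * w) \<le> 1 / sqrt ((a s + a t) / 2)"
      "0 < (a s + a t) / 2 + d s t * w" if "0 < w" for w
      using a[OF \<open>s \<in> _\<close>] a[OF \<open>t \<in> _\<close>] d_nonneg[of s t] that
      by (auto intro!: divide_left_mono mult_pos_pos add_pos_nonneg)
    then show "AE w in F. norm (1 / sqrt ((a s + a t) / 2 + d s t * w)) \<le> 1 / sqrt ((a s + a t) / 2)"
      by (intro AE_I2) (auto simp: spaceF less_imp_le)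
    have "(\<lambda>w. 1 / sqrt ((a s + a t) / 2 + d s t * w)) \<in>
        borel_measurable (restrict_space borel {0<..})"
      by (intro measurable_restrict_space1) measurable
    then show "(\<lambda>w. 1 / sqrt ((a s + a t) / 2 + d s t * w)) \<in> borel_measurable F"
      using measurable_cong_sets[OF setsF refl] by blast
  qed
  show ?thesis
    unfolding pos_semidef_on_def pos_semidef_matrix_def d_def[symmetric]
  proof (intro allI impI conjI ballI)
    fix N and s :: "nat \<Rightarrow> real^2" and i j :: nat
    show "(LINT w|F. sqrt (b (s i) * b (s j)) / sqrt ((a (s i) + a (s j)) / 2 + d (s i) (s j) * w)) =
        (LINT w|F. sqrt (b (s j) * b (s i)) / sqrt ((a (s j) + a (s i)) / 2 + d (s j) (s i) * w))"
      by (simp add: d_commute[of "s i"] mult.commute[of "b (s i)"] add.commute[of "a (s i)"])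
  next
    fix N and s :: "nat \<Rightarrow> real^2" and c :: "nat \<Rightarrow> real"
    assume s: "\<forall>i\<in>{1..N}. s i \<in> network m p q"
    define k where "k i j w = 1 / sqrt ((a (s i) + a (s j)) / 2 + d (s i) (s j) * w)" for i j w
    \<comment> \<open>\<open>sqrt (b s * b t)\<close> factors, so \<open>b\<close> only rescales the
      coefficients.\<close>
    define c' where "c' i = c i * sqrt (b (s i))" for i
    \<comment> \<open>The form is nonnegative for each single \<open>w\<close> in the space of
      \<open>F\<close>, hence so is its integral.\<close>
    have "0 \<le> (LINT w|F. (\<Sum>i\<in>{1..N}. \<Sum>j\<in>{1..N}. c' i * k i j w * c' j))"
    proof (intro integral_nonneg_AE AE_I2)
      fix w assume "w \<in> space F"
      moreover have "0 \<le> (\<Sum>i\<in>{1..N}. \<Sum>j\<in>{1..N}. e i * exp (- r * d (s i) (s j)) * e j)"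
        if "0 \<le> r" for r and e :: "nat \<Rightarrow> real"
        unfolding d_eq using s that by (intro exp_variogram_nonneg X) auto
      ultimately show "0 \<le> (\<Sum>i\<in>{1..N}. \<Sum>j\<in>{1..N}. c' i * k i j w * c' j)"
        unfolding k_def using s
        by (intro inverse_sqrt_variogram_nonneg d_nonneg) (auto simp: spaceF a)
    qed
    also have "\<dots> = (LINT w|F. (\<Sum>i\<in>{1..N}. \<Sum>j\<in>{1..N}. (c' i * c' j) * k i j w))"
      by (simp only: mult_ac)
    also have "\<dots> = (\<Sum>i\<in>{1..N}. \<Sum>j\<in>{1..N}. (c' i * c' j) * (LINT w|F. k i j w))"
      unfolding k_def using s by (intro integral_double_sum int) auto
    also have "\<dots> = (\<Sum>i\<in>{1..N}. \<Sum>j\<in>{1..N}.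
        c i * (LINT w|F. sqrt (b (s i)) * sqrt (b (s j)) * k i j w) * c j)"
      by (intro sum.cong refl) (simp add: c'_def)
    finally show "0 \<le> (\<Sum>i\<in>{1..N}. \<Sum>j\<in>{1..N}. c i *
        (LINT w|F. sqrt (b (s i) * b (s j)) / sqrt ((a (s i) + a (s j)) / 2 + d (s i) (s j) * w)) * c j)"
      by (simp add: k_def real_sqrt_mult)
  qed
qed

end
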